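(* Let $D$ be a division ring, let $n\geq 1$, and let $a\in M_n(D)$ be singular (that is, not invertible). Then $a$ is a product of two commutators in $M_n(D)$, that is, there exist $b,c,d,e\in M_n(D)$ with $a=[b,c][d,e]$.
   Context: The commutator of $x,y$ in a ring is the additive commutator $[x,y]=xy-yx$. *)

theory Defs
  imports "Jordan_Normal_Form.Matrix"
begin

text \<open>
  The additive commutator. The sort is \<open>{times, minus}\<close> rather than \<open>ring\<close> because the type
  of matrices (of arbitrary dimensions) is not an instance of \<open>ring\<close>; on
  \<open>carrier_mat n n\<close> the operations are those of the matrix ring.
\<close>

definition commutator :: "'a :: {times, minus} \<Rightarrow> 'a \<Rightarrow> 'a" where
  "commutator x y = x * y - y * x"

end

theory Submission
  imports Defs
begin

text \<open>
  A singular matrix over a division ring has a nonzero left kernel vector, so it is similar to a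
  matrix with zero first row. Such a matrix is \<open>L * b\<close>, where \<open>L\<close> is the lower shift and \<open>b\<close> is
  obtained by moving all rows up by one; the last row of \<open>b\<close> is arbitrary. The lower shift is the
  commutator of \<open>diag(0, 1, 2, \<dots>)\<close> with \<open>L\<close>. On the other hand, \<open>b\<close> is a commutator with the
  upper shift as soon as its entries sum to zero along each diagonal on or below the main one, and
  each of these diagonals contains exactly one entry of the last row, which can therefore be chosen
  to make all these sums vanish.
\<close>

section \<open>Singular matrices over division rings\<close>

text \<open>Gaussian elimination, by induction on the number of columns: a pivot row clears column
  \<open>n\<close>, which leaves one row fewer for one column fewer. Coefficients stay on the left
  throughout, since scalars need not commute.\<close>

lemma nontrivial_left_relation:
  fixes f :: "'i \<Rightarrow> nat \<Rightarrow> 'a :: division_ring"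
  assumes "finite I" "card I > n"
  shows "\<exists>c. (\<exists>i\<in>I. c i \<noteq> 0) \<and> (\<forall>j<n. (\<Sum>i\<in>I. c i * f i j) = 0)"
  using assms
proof (induction n arbitrary: I f)
  case 0
  then have "I \<noteq> {}" by auto
  then show ?case by (intro exI[of _ "\<lambda>_. 1"]) auto
next
  case (Suc n)
  show ?case
  proof (cases "\<forall>i\<in>I. f i n = 0")
    case True
    obtain c where "\<exists>i\<in>I. c i \<noteq> 0" "\<forall>j<n. (\<Sum>i\<in>I. c i * f i j) = 0"
      using Suc.IH[of I f] Suc.prems by auto
    moreover have "(\<Sum>i\<in>I. c i * f i n) = 0"
      using True by (intro sum.neutral) auto
    ultimately show ?thesis by (metis less_SucE)
  next
    case False
    then obtain p where p: "p \<in> I" "f p n \<noteq> 0" by auto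
    \<comment> \<open>\<open>g i\<close> is row \<open>i\<close> minus the left multiple of the
      pivot row \<open>p\<close> that clears column \<open>n\<close>.\<close>
    define g where "g i j = f i j - f i n * inverse (f p n) * f p j" for i j
    have "finite (I - {p})" "n < card (I - {p})"
      using Suc.prems p by simp_all
    then obtain c where c: "\<exists>i\<in>I - {p}. c i \<noteq> 0" "\<forall>j<n. (\<Sum>i\<in>I - {p}. c i * g i j) = 0"
      using Suc.IH[of "I - {p}" g] by blast
    \<comment> \<open>The multiples of row \<open>p\<close> subtracted in \<open>g\<close> add up to
      \<open>s\<close>; giving \<open>p\<close> the coefficient \<open>- s\<close> turns a relation
      among the \<open>g i\<close> into one among the \<open>f i\<close>.\<close>
    define s where "s = (\<Sum>i\<in>I - {p}. c i * f i n * inverse (f p n))"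
    define c' where "c' = c(p := - s)"
    have eq: "(\<Sum>i\<in>I. c' i * f i j) = (\<Sum>i\<in>I - {p}. c i * g i j)" for j
    proof -
      have "(\<Sum>i\<in>I. c' i * f i j) = - s * f p j + (\<Sum>i\<in>I - {p}. c i * f i j)"
        using Suc.prems p by (simp add: sum.remove[of I p] c'_def)
      also have "\<dots> = (\<Sum>i\<in>I - {p}. c i * g i j)"
        by (simp add: s_def g_def right_diff_distrib sum_subtractf sum_distrib_right mult.assoc)
      finally show ?thesis .
    qed
    have "g i n = 0" for i
      using p by (simp add: g_def mult.assoc)
    then have "\<forall>j<Suc n. (\<Sum>i\<in>I. c' i * f i j) = 0"
      unfolding eq using c(2) by (auto simp: less_Suc_eq)
    moreover have "\<exists>i\<in>I. c' i \<noteq> 0"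
      using c(1) by (auto simp: c'_def)
    ultimately show ?thesis by blast
  qed
qed

lemma index_mult_mat_sum:
  assumes "A \<in> carrier_mat m n" "B \<in> carrier_mat n k" "i < m" "j < k"
  shows "(A * B) $$ (i, j) = (\<Sum>l<n. A $$ (i, l) * B $$ (l, j))"
  using assms by (simp add: scalar_prod_def atLeast0LessThan)

text \<open>Left linear independence of the rows. A row vector is a function on \<open>nat\<close>,
  of which only the values below \<open>n\<close> matter.\<close>

definition left_regular_mat :: "nat \<Rightarrow> 'a :: semiring_0 mat \<Rightarrow> bool" where
  "left_regular_mat n A \<longleftrightarrow>
    (\<forall>c. (\<forall>j<n. (\<Sum>i<n. c i * A $$ (i, j)) = 0) \<longrightarrow> (\<forall>i<n. c i = 0))"

text \<open>The rows of \<open>A\<close> and the unit row \<open>e_k\<close> are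
  \<open>n + 1\<close> rows of length \<open>n\<close>, hence dependent. Independence of the rows of
  \<open>A\<close> puts a nonzero coefficient on \<open>e_k\<close>, and solving for
  \<open>e_k\<close> gives row \<open>k\<close> of the inverse.\<close>

lemma left_regular_mat_left_inverse:
  fixes A :: "'a :: division_ring mat"
  assumes A: "A \<in> carrier_mat n n" and reg: "left_regular_mat n A"
  obtains B where "B \<in> carrier_mat n n" "B * A = 1\<^sub>m n"
proof -
  have "\<exists>b. \<forall>j<n. (\<Sum>i<n. b i * A $$ (i, j)) = (if j = k then 1 else 0)" for k
  proof -
    define f where "f i j = (if i < n then A $$ (i, j) else if j = k then 1 else 0)" for i j
    obtain c where c: "\<exists>i\<in>{..n}. c i \<noteq> 0" "\<forall>j<n. (\<Sum>i\<le>n. c i * f i j) = 0"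
      using nontrivial_left_relation[of "{..n}" n f] by auto
    have rel: "(\<Sum>i<n. c i * A $$ (i, j)) + c n * (if j = k then 1 else 0) = 0" if "j < n" for j
    proof -
      have "(\<Sum>i<n. c i * f i j) = (\<Sum>i<n. c i * A $$ (i, j))"
        by (intro sum.cong) (auto simp: f_def)
      then show ?thesis
        using c(2) that by (simp add: lessThan_Suc_atMost[symmetric] f_def)
    qed
    have "c n \<noteq> 0"
    proof
      assume "c n = 0"
      then have "\<forall>i<n. c i = 0"
        using rel reg by (simp add: left_regular_mat_def)
      with \<open>c n = 0\<close> c(1) show False by (auto simp: le_less)
    qed
    show ?thesis
    proof (intro exI allI impI)
      fix j assume "j < n"
      have "(\<Sum>i<n. (- inverse (c n) * c i) * A $$ (i, j))
          = - inverse (c n) * (\<Sum>i<n. c i * A $$ (i, j))"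
        by (simp add: sum_distrib_left mult.assoc sum_negf)
      also have "(\<Sum>i<n. c i * A $$ (i, j)) = - (c n * (if j = k then 1 else 0))"
        using rel[OF \<open>j < n\<close>] by (simp add: eq_neg_iff_add_eq_0)
      finally show "(\<Sum>i<n. (- inverse (c n) * c i) * A $$ (i, j)) = (if j = k then 1 else 0)"
        using \<open>c n \<noteq> 0\<close> by (auto split: if_splits)
    qed
  qed
  then obtain b where b: "\<And>k j. j < n \<Longrightarrow> (\<Sum>i<n. b k i * A $$ (i, j)) = (if j = k then 1 else 0)"
    by metis
  let ?B = "mat n n (\<lambda>(k, i). b k i)"
  have "?B * A = 1\<^sub>m n"
    using A b by (intro eq_matI) (auto simp: index_mult_mat_sum[of _ n n _ n] simp del: index_mult_mat(1))
  then show ?thesis by (intro that[of ?B]) auto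
qed

text \<open>If \<open>c * B = 0\<close> then \<open>c = c * B * A = 0\<close>, so the left inverse
  \<open>B\<close> is itself left regular and has a left inverse \<open>C\<close>; then
  \<open>C = C * B * A = A\<close>.\<close>

lemma left_regular_mat_inverse:
  fixes A :: "'a :: division_ring mat"
  assumes A: "A \<in> carrier_mat n n" and reg: "left_regular_mat n A"
  obtains B where "B \<in> carrier_mat n n" "A * B = 1\<^sub>m n" "B * A = 1\<^sub>m n"
proof -
  obtain B where B: "B \<in> carrier_mat n n" "B * A = 1\<^sub>m n"
    using left_regular_mat_left_inverse[OF A reg] .
  have "left_regular_mat n B"
    unfolding left_regular_mat_def
  proof (intro allI impI)
    fix c :: "nat \<Rightarrow> 'a" and k
    assume c: "\<forall>j<n. (\<Sum>i<n. c i * B $$ (i, j)) = 0" and k: "k < n"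
    let ?c = "mat 1 n (\<lambda>(_, i). c i)"
    have "?c * B = 0\<^sub>m 1 n"
      using B c by (intro eq_matI) (auto simp: index_mult_mat_sum[of _ 1 n _ n] simp del: index_mult_mat(1))
    moreover have "?c * B * A = ?c * (B * A)"
      using A B(1) by (intro assoc_mult_mat) auto
    ultimately have "?c * (B * A) = 0\<^sub>m 1 n"
      using A by simp
    moreover have "?c * (B * A) = ?c"
      unfolding B(2) by (intro right_mult_one_mat) auto
    ultimately have "?c = 0\<^sub>m 1 n" by simp
    then have "?c $$ (0, k) = 0\<^sub>m 1 n $$ (0, k)" by simp
    then show "c k = 0" using k by simp
  qed
  then obtain C where C: "C \<in> carrier_mat n n" "C * B = 1\<^sub>m n"
    using left_regular_mat_left_inverse[OF B(1)] by blast
  have "C = C * (B * A)" using B C by simp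
  also have "\<dots> = (C * B) * A" using A B(1) C(1) by simp
  also have "\<dots> = A" using A C by simp
  finally show ?thesis using B C that by blast
qed

text \<open>\<open>P\<close> is an invertible matrix whose first row is a nonzero left kernel vector
  \<open>v\<close> of \<open>A\<close>. The first row of \<open>P * A\<close> then vanishes, and
  multiplying by \<open>Q\<close> on the right keeps it zero.\<close>

lemma not_invertible_mat_imp_similar_zero_row:
  fixes A :: "'a :: division_ring mat"
  assumes A: "A \<in> carrier_mat n n" and sing: "\<not> invertible_mat A"
  obtains P Q where "P \<in> carrier_mat n n" "Q \<in> carrier_mat n n"
    "P * Q = 1\<^sub>m n" "Q * P = 1\<^sub>m n" "\<And>j. j < n \<Longrightarrow> (P * A * Q) $$ (0, j) = 0"
proof -
  have "\<not> left_regular_mat n A"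
  proof
    assume "left_regular_mat n A"
    then obtain B where "B \<in> carrier_mat n n" "A * B = 1\<^sub>m n" "B * A = 1\<^sub>m n"
      using left_regular_mat_inverse[OF A] by blast
    then show False
      using A sing by (auto simp: invertible_mat_def inverts_mat_def)
  qed
  then obtain v k where v: "\<And>j. j < n \<Longrightarrow> (\<Sum>i<n. v i * A $$ (i, j)) = 0"
    and k: "k < n" "v k \<noteq> 0"
    by (auto simp: left_regular_mat_def)
  \<comment> \<open>For \<open>0 < i < n\<close>, \<open>\<sigma> i\<close> runs through all indices
    below \<open>n\<close> other than \<open>k\<close>, so the rows of \<open>P\<close> are
    \<open>v\<close> and every unit row except the one at \<open>k\<close>, where \<open>v\<close>
    is nonzero.\<close>
  define \<sigma> where "\<sigma> i = (if i = k then 0 else i)" for i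
  define P where "P = mat n n (\<lambda>(i, j). if i = 0 then v j else if j = \<sigma> i then 1 else 0)"
  have P: "P \<in> carrier_mat n n" by (simp add: P_def)
  have "left_regular_mat n P"
    unfolding left_regular_mat_def
  proof (intro allI impI)
    fix c :: "nat \<Rightarrow> 'a" and l
    assume c: "\<forall>j<n. (\<Sum>i<n. c i * P $$ (i, j)) = 0" and l: "l < n"
    \<comment> \<open>Column \<open>k\<close> of \<open>P\<close> has \<open>v k\<close> on top and
      zeros below, which forces \<open>c 0 = 0\<close>; after that, column \<open>\<sigma> l\<close>
      isolates \<open>c l\<close>.\<close>
    have "(\<Sum>i<n. c i * P $$ (i, k)) = (\<Sum>i<n. if i = 0 then c 0 * v k else 0)"
      using k by (intro sum.cong) (auto simp: P_def \<sigma>_def)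
    then have c0: "c 0 = 0"
      using c k by simp
    have "(\<Sum>i<n. c i * P $$ (i, \<sigma> l)) = (\<Sum>i<n. if i = l then c l else 0)" if "l \<noteq> 0"
      using c0 k l that by (intro sum.cong) (auto simp: P_def \<sigma>_def)
    moreover have "\<sigma> l < n" using l by (auto simp: \<sigma>_def)
    ultimately show "c l = 0" using c c0 l by (cases "l = 0") auto
  qed
  then obtain Q where Q: "Q \<in> carrier_mat n n" "P * Q = 1\<^sub>m n" "Q * P = 1\<^sub>m n"
    using left_regular_mat_inverse[OF P] by blast
  have "(P * A * Q) $$ (0, j) = 0" if "j < n" for j
  proof -
    have "(P * A) $$ (0, i) = 0" if "i < n" for i
    proof -
      have "(P * A) $$ (0, i) = (\<Sum>l<n. P $$ (0, l) * A $$ (l, i))"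
        using P A that by (intro index_mult_mat_sum) auto
      also have "\<dots> = (\<Sum>l<n. v l * A $$ (l, i))"
        using that by (intro sum.cong) (auto simp: P_def)
      finally show ?thesis using v that by simp
    qed
    moreover have "(P * A * Q) $$ (0, j) = (\<Sum>i<n. (P * A) $$ (0, i) * Q $$ (i, j))"
      using P A Q that by (intro index_mult_mat_sum[of _ n]) auto
    ultimately show ?thesis by simp
  qed
  with P Q that show ?thesis by blast
qed

section \<open>Commutators with shift matrices\<close>

definition upper_shift_mat :: "nat \<Rightarrow> 'a :: {zero, one} mat" where
  "upper_shift_mat n = mat n n (\<lambda>(i, j). if j = Suc i then 1 else 0)"

definition lower_shift_mat :: "nat \<Rightarrow> 'a :: {zero, one} mat" where
  "lower_shift_mat n = mat n n (\<lambda>(i, j). if i = Suc j then 1 else 0)"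

lemma shift_mat_carrier [simp]:
  "upper_shift_mat n \<in> carrier_mat n n" "lower_shift_mat n \<in> carrier_mat n n"
  by (simp_all add: upper_shift_mat_def lower_shift_mat_def)

lemma upper_shift_mat_mult_index:
  fixes Y :: "'a :: semiring_1 mat"
  assumes Y: "Y \<in> carrier_mat n n" and ij: "i < n" "j < n"
  shows "(upper_shift_mat n * Y) $$ (i, j) = (if Suc i < n then Y $$ (Suc i, j) else 0)"
proof -
  have "(upper_shift_mat n * Y) $$ (i, j) = (\<Sum>l<n. upper_shift_mat n $$ (i, l) * Y $$ (l, j))"
    using Y ij by (intro index_mult_mat_sum) auto
  also have "\<dots> = (\<Sum>l<n. if l = Suc i then Y $$ (Suc i, j) else 0)"
    using ij by (intro sum.cong) (auto simp: upper_shift_mat_def)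
  finally show ?thesis by simp
qed

lemma mult_upper_shift_mat_index:
  fixes Y :: "'a :: semiring_1 mat"
  assumes Y: "Y \<in> carrier_mat n n" and ij: "i < n" "j < n"
  shows "(Y * upper_shift_mat n) $$ (i, j) = (if j = 0 then 0 else Y $$ (i, j - 1))"
proof -
  have "(Y * upper_shift_mat n) $$ (i, j) = (\<Sum>l<n. Y $$ (i, l) * upper_shift_mat n $$ (l, j))"
    using Y ij by (intro index_mult_mat_sum) auto
  also have "\<dots> = (\<Sum>l<n. if l = j - 1 then (if j = 0 then 0 else Y $$ (i, j - 1)) else 0)"
    using ij by (intro sum.cong) (auto simp: upper_shift_mat_def)
  finally show ?thesis using ij by (simp add: less_imp_diff_less)
qed

lemma lower_shift_mat_mult_index:
  fixes Y :: "'a :: semiring_1 mat"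
  assumes Y: "Y \<in> carrier_mat n n" and ij: "i < n" "j < n"
  shows "(lower_shift_mat n * Y) $$ (i, j) = (if i = 0 then 0 else Y $$ (i - 1, j))"
proof -
  have "(lower_shift_mat n * Y) $$ (i, j) = (\<Sum>l<n. lower_shift_mat n $$ (i, l) * Y $$ (l, j))"
    using Y ij by (intro index_mult_mat_sum) auto
  also have "\<dots> = (\<Sum>l<n. if l = i - 1 then (if i = 0 then 0 else Y $$ (i - 1, j)) else 0)"
    using ij by (intro sum.cong) (auto simp: lower_shift_mat_def)
  finally show ?thesis using ij by (simp add: less_imp_diff_less)
qed

text \<open>Commuting with \<open>D\<close> multiplies entry \<open>(i, j)\<close> by the integer
  \<open>i - j\<close>, which is 1 on the subdiagonal in every characteristic.\<close>

lemma lower_shift_mat_eq_commutator: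
  fixes n :: nat
  defines "D \<equiv> mat n n (\<lambda>(i, j). if i = j then of_nat i else 0) :: 'a :: ring_1 mat"
  shows "lower_shift_mat n = commutator D (lower_shift_mat n)"
proof (rule eq_matI)
  let ?L = "lower_shift_mat n :: 'a mat"
  have D: "D \<in> carrier_mat n n" by (simp add: D_def)
  then have com: "commutator D ?L \<in> carrier_mat n n"
    using minus_carrier_mat mult_carrier_mat shift_mat_carrier(2) by (metis commutator_def)
  show "dim_row ?L = dim_row (commutator D ?L)" "dim_col ?L = dim_col (commutator D ?L)"
    using com by (simp_all add: lower_shift_mat_def)
  fix i j assume "i < dim_row (commutator D ?L)" "j < dim_col (commutator D ?L)"
  then have ij: "i < n" "j < n" using com by auto
  have "(D * ?L) $$ (i, j) = (\<Sum>l<n. D $$ (i, l) * ?L $$ (l, j))"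
    using D ij by (intro index_mult_mat_sum) auto
  also have "\<dots> = (\<Sum>l<n. if l = i then of_nat i * ?L $$ (i, j) else 0)"
    using ij by (intro sum.cong) (auto simp: D_def)
  also have "\<dots> = of_nat i * ?L $$ (i, j)" using ij by simp
  finally have DL: "(D * ?L) $$ (i, j) = of_nat i * ?L $$ (i, j)" .
  have "commutator D ?L $$ (i, j) = (D * ?L) $$ (i, j) - (?L * D) $$ (i, j)"
    unfolding commutator_def using D ij
    by (intro index_minus_mat) (auto simp: lower_shift_mat_def)
  also have "\<dots> = ?L $$ (i, j)"
    unfolding DL lower_shift_mat_mult_index[OF D ij]
    using ij by (auto simp: lower_shift_mat_def D_def)
  finally show "?L $$ (i, j) = commutator D ?L $$ (i, j)" by simp
qed

lemma zero_diagonal_sums_imp_commutator: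
  fixes X :: "'a :: ring_1 mat"
  assumes X: "X \<in> carrier_mat n n"
    and diag: "\<And>j. j < n \<Longrightarrow> (\<Sum>t\<le>j. X $$ (n - 1 - t, j - t)) = 0"
  obtains Y where "Y \<in> carrier_mat n n" "X = commutator (upper_shift_mat n) Y"
proof -
  \<comment> \<open>The equation \<open>X (i, j) = Y (i + 1, j) - Y (i, j - 1)\<close> is solved by telescoping along
    diagonals; \<open>diag\<close> is the compatibility condition in the last row, where \<open>Y (n, j) = 0\<close>.\<close>
  define S where "S i j = (\<Sum>t\<le>min i j. X $$ (i - t, j - t))" for i j
  have S_rec: "S i j = X $$ (i, j) + (if i = 0 \<or> j = 0 then 0 else S (i - 1) (j - 1))" for i j
    by (cases i; cases j) (simp_all add: S_def sum.atMost_Suc_shift del: sum.atMost_Suc)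
  \<comment> \<open>From the last row the diagonal ends in column 0, so \<open>S\<close> is exactly
    the sum in \<open>diag\<close>. The value 0 matches the zero last row of
    \<open>upper_shift_mat n * Y\<close>.\<close>
  have S_last: "S (n - 1) j = 0" if "j < n" for j
    using diag[OF that] that by (simp add: S_def min_absorb2)
  \<comment> \<open>Row 0 of \<open>Y\<close> is a free choice; with zeros there, the equation makes
    \<open>Y (i + 1, j)\<close> the sum \<open>S i j\<close> of \<open>X\<close> from
    \<open>(i, j)\<close> up the diagonal.\<close>
  define Y where "Y = mat n n (\<lambda>(i, j). if i = 0 then 0 else S (i - 1) j)"
  have Y: "Y \<in> carrier_mat n n" by (simp add: Y_def)
  let ?N = "upper_shift_mat n :: 'a mat"
  have com: "commutator ?N Y \<in> carrier_mat n n"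
    using Y minus_carrier_mat mult_carrier_mat shift_mat_carrier(1) by (metis commutator_def)
  have "X = commutator ?N Y"
  proof (rule eq_matI)
    show "dim_row X = dim_row (commutator ?N Y)" "dim_col X = dim_col (commutator ?N Y)"
      using X com by auto
    fix i j assume "i < dim_row (commutator ?N Y)" "j < dim_col (commutator ?N Y)"
    then have ij: "i < n" "j < n" using com by auto
    have "commutator ?N Y $$ (i, j) = (?N * Y) $$ (i, j) - (Y * ?N) $$ (i, j)"
      unfolding commutator_def using Y ij
      by (intro index_minus_mat) (auto simp: upper_shift_mat_def)
    also have "(?N * Y) $$ (i, j) = S i j"
    proof (cases "Suc i < n")
      case True
      then show ?thesis unfolding upper_shift_mat_mult_index[OF Y ij] using ij by (simp add: Y_def)
    next
      case False
      then have "i = n - 1" using ij by simp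
      then show ?thesis
        unfolding upper_shift_mat_mult_index[OF Y ij] using False S_last ij by simp
    qed
    also have "(Y * ?N) $$ (i, j) = (if i = 0 \<or> j = 0 then 0 else S (i - 1) (j - 1))"
      unfolding mult_upper_shift_mat_index[OF Y ij] using ij by (auto simp: Y_def)
    also have "S i j - \<dots> = X $$ (i, j)"
      by (subst S_rec) simp
    finally show "X $$ (i, j) = commutator ?N Y $$ (i, j)" by simp
  qed
  with Y that show ?thesis by blast
qed

lemma zero_row_imp_shift_mult_commutator:
  fixes A :: "'a :: ring_1 mat"
  assumes A: "A \<in> carrier_mat n n" and zero: "\<And>j. j < n \<Longrightarrow> A $$ (0, j) = 0"
  obtains Y where "Y \<in> carrier_mat n n"
    "A = lower_shift_mat n * commutator (upper_shift_mat n) Y"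
proof -
  \<comment> \<open>The lower shift discards the last row of \<open>X\<close>, so its entry in
    column \<open>j\<close> is free to cancel the rest of its diagonal, which consists of the
    entries of \<open>A\<close> from \<open>(n - 1, j - 1)\<close> upwards.\<close>
  define X where "X = mat n n (\<lambda>(i, j). if Suc i < n then A $$ (Suc i, j)
    else - (\<Sum>t<j. A $$ (n - 1 - t, j - 1 - t)))"
  have X: "X \<in> carrier_mat n n" by (simp add: X_def)
  have X_up: "X $$ (i, j) = A $$ (Suc i, j)" if "Suc i < n" "j < n" for i j
    using that by (simp add: X_def)
  have diag: "(\<Sum>t\<le>j. X $$ (n - 1 - t, j - t)) = 0" if "j < n" for j
  proof -
    have "(\<Sum>t\<le>j. X $$ (n - 1 - t, j - t))
        = X $$ (n - 1, j) + (\<Sum>t<j. X $$ (n - 1 - Suc t, j - Suc t))"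
      by (simp add: sum.atMost_shift)
    also have "(\<Sum>t<j. X $$ (n - 1 - Suc t, j - Suc t)) = (\<Sum>t<j. A $$ (n - 1 - t, j - 1 - t))"
    proof (rule sum.cong)
      fix t assume "t \<in> {..<j}"
      \<comment> \<open>Since \<open>t < j < n\<close>, none of these subtractions on
        \<open>nat\<close> truncates.\<close>
      then have t: "Suc (n - 1 - Suc t) = n - 1 - t" "n - 1 - t < n" "j - Suc t < n"
        using that by auto
      show "X $$ (n - 1 - Suc t, j - Suc t) = A $$ (n - 1 - t, j - 1 - t)"
        using X_up[of "n - 1 - Suc t" "j - Suc t"] t by (simp only: diff_diff_left plus_1_eq_Suc)
    qed simp
    also have "X $$ (n - 1, j) = - (\<Sum>t<j. A $$ (n - 1 - t, j - 1 - t))"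
      using that by (simp add: X_def)
    finally show ?thesis by simp
  qed
  obtain Y where Y: "Y \<in> carrier_mat n n" "X = commutator (upper_shift_mat n) Y"
    using zero_diagonal_sums_imp_commutator[OF X diag] .
  have "A = lower_shift_mat n * X"
  proof (rule eq_matI)
    fix i j assume "i < dim_row (lower_shift_mat n * X)" "j < dim_col (lower_shift_mat n * X)"
    then have ij: "i < n" "j < n" using X by (auto simp: lower_shift_mat_def)
    show "A $$ (i, j) = (lower_shift_mat n * X) $$ (i, j)"
      unfolding lower_shift_mat_mult_index[OF X ij] using zero ij by (simp add: X_def)
  qed (use A X in \<open>auto simp: lower_shift_mat_def\<close>)
  with Y that show ?thesis by blast
qed

section \<open>Conjugation\<close>

lemma conjugate_mult_mat:
  fixes P Q x y :: "'a :: semiring_1 mat"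
  assumes "P \<in> carrier_mat n n" "Q \<in> carrier_mat n n" "x \<in> carrier_mat n n" "y \<in> carrier_mat n n"
    and PQ: "P * Q = 1\<^sub>m n"
  shows "(Q * x * P) * (Q * y * P) = Q * (x * y) * P"
proof -
  have "(Q * x * P) * (Q * y * P) = Q * x * ((P * Q) * (y * P))"
    using assms(1-4) by (simp add: assoc_mult_mat[of _ n n _ n _ n])
  also have "\<dots> = Q * (x * y) * P"
    using assms by (simp add: assoc_mult_mat[of _ n n _ n _ n])
  finally show ?thesis .
qed

text \<open>Conjugation respects products, because the inner \<open>P * Q\<close> cancels, and
  differences, by distributivity; hence it respects commutators.\<close>

lemma conjugate_commutator:
  fixes P Q x y :: "'a :: ring_1 mat"
  assumes P: "P \<in> carrier_mat n n" and Q: "Q \<in> carrier_mat n n"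
    and x: "x \<in> carrier_mat n n" and y: "y \<in> carrier_mat n n" and PQ: "P * Q = 1\<^sub>m n"
  shows "Q * commutator x y * P = commutator (Q * x * P) (Q * y * P)"
proof -
  have "Q * commutator x y = Q * (x * y) - Q * (y * x)"
    unfolding commutator_def using Q x y by (intro mult_minus_distrib_mat) auto
  moreover have "\<dots> * P = Q * (x * y) * P - Q * (y * x) * P"
    using P Q x y by (intro minus_mult_distrib_mat) auto
  ultimately show ?thesis
    by (simp only: commutator_def[of "Q * x * P"] conjugate_mult_mat[OF P Q x y PQ]
        conjugate_mult_mat[OF P Q y x PQ])
qed

theorem proposition4p7:
  fixes a :: "'a :: division_ring mat" and n :: nat
  assumes "n \<ge> 1"
    and "a \<in> carrier_mat n n"
    and "\<not> invertible_mat a"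
  shows "\<exists>b \<in> carrier_mat n n. \<exists>c \<in> carrier_mat n n.
         \<exists>d \<in> carrier_mat n n. \<exists>e \<in> carrier_mat n n.
           a = commutator b c * commutator d e"
proof -
  obtain P Q where P: "P \<in> carrier_mat n n" and Q: "Q \<in> carrier_mat n n"
    and PQ: "P * Q = 1\<^sub>m n" and QP: "Q * P = 1\<^sub>m n"
    and zero: "\<And>j. j < n \<Longrightarrow> (P * a * Q) $$ (0, j) = 0"
    using not_invertible_mat_imp_similar_zero_row[OF assms(2,3)] by blast
  have "P * a * Q \<in> carrier_mat n n" using P Q assms(2) by simp
  then obtain Y where Y: "Y \<in> carrier_mat n n"
    and eq: "P * a * Q = lower_shift_mat n * commutator (upper_shift_mat n) Y"
    using zero_row_imp_shift_mult_commutator zero by blast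
  define D :: "'a mat" where "D = mat n n (\<lambda>(i, j). if i = j then of_nat i else 0)"
  have D: "D \<in> carrier_mat n n" by (simp add: D_def)
  let ?L = "lower_shift_mat n :: 'a mat" and ?N = "upper_shift_mat n :: 'a mat"
  have L: "?L = commutator D ?L"
    unfolding D_def by (rule lower_shift_mat_eq_commutator)
  have NY: "commutator ?N Y \<in> carrier_mat n n"
    using Y minus_carrier_mat mult_carrier_mat shift_mat_carrier(1) by (metis commutator_def)
  \<comment> \<open>As \<open>Q * P\<close> is the identity, \<open>a\<close> is recovered from the
    matrix \<open>P * a * Q\<close> with zero first row; conjugating the two factors of the latter
    separately gives the factors of \<open>a\<close>.\<close>
  have "a = (Q * P) * a * (Q * P)"
    using assms(2) QP by simp
  also have "\<dots> = Q * (P * a * Q) * P"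
    using P Q assms(2) by (simp add: assoc_mult_mat[of _ n n _ n _ n])
  also have "\<dots> = (Q * ?L * P) * (Q * commutator ?N Y * P)"
    unfolding eq using conjugate_mult_mat[OF P Q _ NY PQ] by simp
  also have "Q * ?L * P = commutator (Q * D * P) (Q * ?L * P)"
    using conjugate_commutator[OF P Q D _ PQ, of ?L] L by simp
  also have "Q * commutator ?N Y * P = commutator (Q * ?N * P) (Q * Y * P)"
    using conjugate_commutator[OF P Q _ Y PQ] by simp
  finally have "a = commutator (Q * D * P) (Q * ?L * P) * commutator (Q * ?N * P) (Q * Y * P)" .
  moreover have "Q * D * P \<in> carrier_mat n n" "Q * ?L * P \<in> carrier_mat n n"
    "Q * ?N * P \<in> carrier_mat n n" "Q * Y * P \<in> carrier_mat n n"
    using P Q D Y by (auto intro!: mult_carrier_mat[of _ n n _ n])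
  ultimately show ?thesis by blast
qed

end
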